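(* Let $T>0$, $\varepsilon>0$, $N\ge 0$, and let $e$ be real-valued (possibly a function of time). Define $$\overline D^N=\tfrac12 D^N-\tfrac12\,(A^N+\varepsilon I^N)^{-1}(D^N)^T(A^N+\varepsilon I^N).$$ Then every differentiable solution $t\mapsto U^N(t)\in\mathbb R^{N+1}$ of $$\partial_t U^N+\overline D^N U^N=0$$ satisfies $$\frac{d}{dt}\left(\left\langle U^N,A^NU^N\right\rangle+\varepsilon\|U^N\|^2\right)=0 .$$
   Context: $\langle\cdot,\cdot\rangle$ and $\|\cdot\|$ are the Euclidean scalar product and norm on $\mathbb R^{N+1}$; $I^N$ is the identity matrix of size $N+1$. $H_m$ denotes the (physicists') Hermite polynomial, $H_m(x)=(-1)^m e^{x^2}\frac{d^m}{dx^m}e^{-x^2}$. For fixed $T>0$ the asymmetric Hermite functions are $\psi_m(v)=e^{-v^2/T}T^{-\frac12}(2^m m!\sqrt{\pi})^{-\frac12}H_m(v/\sqrt T)$. $A^N=(a_{mn})_{0\le m,n\le N}$ with $a_{mn}=\int_{\mathbb R}\psi_m\psi_n\,dv$ is the truncated Gram matrix (symmetric positive definite), and $D^N=(d_{mn})_{0\le m,n\le N}$ with $d_{mn}=-e\sqrt{\frac{2m}{T}}\,\delta_{m-1,n}$. Equivalently, $\overline D^N=D^N-\frac12(A^N+\varepsilon I^N)^{-1}\big((A^N+\varepsilon I^N)D^N+(D^N)^T(A^N+\varepsilon I^N)\big)$. *)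

theory Defs
  imports "HOL-Analysis.Analysis" "Jordan_Normal_Form.Gauss_Jordan_Elimination"
begin

(* Vectors of R^(N+1) and matrices with indices 0, ..., N are the dimension-carrying
   types vec and mat of Jordan_Normal_Form, so that N is an ordinary natural number. *)

definition hermite :: "nat \<Rightarrow> real \<Rightarrow> real" where
  "hermite m x = (-1) ^ m * exp (x\<^sup>2) * (deriv ^^ m) (\<lambda>y. exp (- (y\<^sup>2))) x"

definition hermite_fun :: "real \<Rightarrow> nat \<Rightarrow> real \<Rightarrow> real" where
  "hermite_fun T m v =
     exp (- (v\<^sup>2 / T)) * T powr (- 1 / 2) * (2 ^ m * fact m * sqrt pi) powr (- 1 / 2)
       * hermite m (v / sqrt T)"

definition gram_mat :: "real \<Rightarrow> nat \<Rightarrow> real mat" where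
  "gram_mat T N =
     mat (N + 1) (N + 1) (\<lambda>(m, n). LINT v|lborel. hermite_fun T m v * hermite_fun T n v)"

(* The Kronecker delta of m - 1 and n is the test m = n + 1: the entries with m = 0 vanish,
   which truncated subtraction on nat would not give for n = 0. *)
definition D_mat :: "real \<Rightarrow> nat \<Rightarrow> real \<Rightarrow> real mat" where
  "D_mat T N e =
     mat (N + 1) (N + 1) (\<lambda>(m, n). - e * sqrt (2 * real m / T) * (if m = n + 1 then 1 else 0))"

definition reg_gram_mat :: "real \<Rightarrow> real \<Rightarrow> nat \<Rightarrow> real mat" where
  "reg_gram_mat T \<epsilon> N = gram_mat T N + \<epsilon> \<cdot>\<^sub>m 1\<^sub>m (N + 1)"

(* mat_inverse returns an option. For T > 0 and eps > 0 the regularised Gram matrix is symmetric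
   positive definite, so the value is Some of the two-sided inverse. *)
definition D_bar_mat :: "real \<Rightarrow> real \<Rightarrow> nat \<Rightarrow> real \<Rightarrow> real mat" where
  "D_bar_mat T \<epsilon> N e =
     (1 / 2) \<cdot>\<^sub>m D_mat T N e
     - (1 / 2) \<cdot>\<^sub>m (the (mat_inverse (reg_gram_mat T \<epsilon> N))
                    * transpose_mat (D_mat T N e) * reg_gram_mat T \<epsilon> N)"

definition euclid_norm :: "real vec \<Rightarrow> real" where
  "euclid_norm u = sqrt (scalar_prod u u)"

(* The type vec carries no topology; derivatives are taken componentwise. *)
definition has_vec_derivative ::
    "(real \<Rightarrow> real vec) \<Rightarrow> real vec \<Rightarrow> real filter \<Rightarrow> bool" where
  "has_vec_derivative U U' F \<longleftrightarrow>
     (\<forall>i < dim_vec U'. ((\<lambda>s. vec_index (U s) i) has_real_derivative vec_index U' i) F)"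

end

theory Submission
  imports Defs "HOL-Probability.Distributions" "Jordan_Normal_Form.Determinant"
begin

text \<open>
  Put \<open>M = A + \<epsilon>I\<close>, so that the conserved quantity is \<open>\<langle>U, M U\<rangle>\<close>. Its derivative is
  \<open>2\<langle>U, M U'\<rangle>\<close> by symmetry of \<open>M\<close>, and along a solution \<open>2 M U' = - (M D - D\<^sup>T M) U\<close>
  because \<open>M\<close> cancels its inverse in \<open>D_bar\<close>. The matrix \<open>M D - D\<^sup>T M\<close> is skew-symmetric.
  Invertibility of \<open>M\<close> follows from \<open>\<langle>u, A u\<rangle> = \<integral> (\<Sum> u\<^sub>i \<psi>\<^sub>i)\<^sup>2 \<ge> 0\<close>, where the products
  \<open>\<psi>\<^sub>i \<psi>\<^sub>j\<close> are integrable as polynomials times a Gaussian.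
\<close>

section \<open>Integrability of products of Hermite functions\<close>

lemma integrable_poly_gaussian:
  fixes c :: real
  assumes "c > 0"
  shows "integrable lborel (\<lambda>x. poly p x * exp (- (c * x\<^sup>2)))"
proof -
  have monomial: "integrable lborel (\<lambda>x::real. x ^ k * exp (- (c * x\<^sup>2)))" for k
  proof -
    \<comment> \<open>Substituting \<open>a * x\<close> for the variable turns
      \<open>exp (- (c * x\<^sup>2))\<close> into \<open>exp (- (x\<^sup>2 / 2))\<close>, which
      reduces the claim to the moments of the standard normal density.\<close>
    define a where "a = 1 / sqrt (2 * c)"
    have a: "a > 0" "c * a\<^sup>2 = 1 / 2"
      using assms by (auto simp: a_def power_divide)
    have exponent: "c * (a\<^sup>2 * x\<^sup>2) = x\<^sup>2 / 2" for x
      using a(2) by (simp flip: mult.assoc)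
    have "integrable lborel (\<lambda>x. (sqrt (2 * pi) * a ^ k) * (std_normal_density x * x ^ k))"
      by (intro integrable_mult_right integrable_std_normal_moment)
    \<comment> \<open>The summand \<open>0 +\<close> gives the integrand the affine form that
      \<open>lborel_integrable_real_affine_iff\<close> expects; the factor
      \<open>sqrt (2 * pi) * a ^ k\<close> undoes the normalisation and the scaling of the
      monomial.\<close>
    also have "(\<lambda>x. (sqrt (2 * pi) * a ^ k) * (std_normal_density x * x ^ k)) =
        (\<lambda>x. (0 + a * x) ^ k * exp (- (c * (0 + a * x)\<^sup>2)))"
      by (auto simp: std_normal_density_def exponent power_mult_distrib)
    finally show ?thesis
      using a(1) by (subst (asm) lborel_integrable_real_affine_iff) auto
  qed
  have "integrable lborel (\<lambda>x. \<Sum>k\<le>degree p. coeff p k * (x ^ k * exp (- (c * x\<^sup>2))))"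
    by (intro Bochner_Integration.integrable_sum integrable_mult_right monomial)
  then show ?thesis
    by (simp add: poly_altdef sum_distrib_right mult.assoc)
qed

text \<open>Polynomials times the Gaussian are closed under differentiation: the factor p becomes p'
  - 2 y p. The equality is one of functions because the next \<open>deriv\<close> acts on the whole
  function.\<close>

lemma funpow_deriv_gaussian:
  "\<exists>p. (deriv ^^ m) (\<lambda>y::real. exp (- (y\<^sup>2))) = (\<lambda>y. poly p y * exp (- (y\<^sup>2)))"
proof (induction m)
  case 0
  show ?case
    by (intro exI[of _ "1"]) simp
next
  case (Suc m)
  then obtain p where p: "(deriv ^^ m) (\<lambda>y::real. exp (- (y\<^sup>2))) = (\<lambda>y. poly p y * exp (- (y\<^sup>2)))"
    by blast
  have "((\<lambda>y. poly p y * exp (- (y\<^sup>2))) has_real_derivative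
      poly (pderiv p - [:0, 2:] * p) y * exp (- (y\<^sup>2))) (at y)" for y
    by (auto intro!: derivative_eq_intros simp: algebra_simps)
  then have "deriv (\<lambda>y. poly p y * exp (- (y\<^sup>2))) =
      (\<lambda>y. poly (pderiv p - [:0, 2:] * p) y * exp (- (y\<^sup>2)))"
    by (intro ext DERIV_imp_deriv)
  then show ?case
    using p by (intro exI[of _ "pderiv p - [:0, 2:] * p"]) (simp del: poly_diff poly_mult)
qed

lemma hermite_eq_poly: "\<exists>p. hermite m = poly p"
proof -
  obtain p where p: "(deriv ^^ m) (\<lambda>y::real. exp (- (y\<^sup>2))) = (\<lambda>y. poly p y * exp (- (y\<^sup>2)))"
    using funpow_deriv_gaussian by blast
  \<comment> \<open>The first \<open>simp\<close> must still see the exponential of a negative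
    argument in order to apply \<open>p\<close>; only then may \<open>exp_minus\<close> cancel it
    against \<open>exp (x\<^sup>2)\<close>.\<close>
  have "hermite m x = poly (Polynomial.smult ((-1) ^ m) p) x" for x
    by (simp add: hermite_def p) (simp add: exp_minus)
  then show ?thesis
    by blast
qed

lemma hermite_fun_eq_poly_gaussian:
  "\<exists>p. \<forall>v. hermite_fun T m v = poly p v * exp (- (v\<^sup>2 / T))"
proof -
  obtain p where p: "hermite m = poly p"
    using hermite_eq_poly by blast
  let ?q = "Polynomial.smult (T powr (- 1 / 2) * (2 ^ m * fact m * sqrt pi) powr (- 1 / 2))
    (pcompose p [:0, 1 / sqrt T:])"
  have "hermite_fun T m v = poly ?q v * exp (- (v\<^sup>2 / T))" for v
    by (simp add: hermite_fun_def p poly_pcompose)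
  then show ?thesis
    by blast
qed

lemma integrable_hermite_fun_mult:
  assumes "T > 0"
  shows "integrable lborel (\<lambda>v. hermite_fun T m v * hermite_fun T n v)"
proof -
  obtain p q where
    pq: "\<And>v. hermite_fun T m v = poly p v * exp (- (v\<^sup>2 / T))"
      "\<And>v. hermite_fun T n v = poly q v * exp (- (v\<^sup>2 / T))"
    using hermite_fun_eq_poly_gaussian by metis
  have "hermite_fun T m v * hermite_fun T n v = poly (p * q) v * exp (- ((2 / T) * v\<^sup>2))" for v
  proof -
    have "exp (- (v\<^sup>2 / T)) * exp (- (v\<^sup>2 / T)) = exp (- ((2 / T) * v\<^sup>2))"
      by (simp flip: exp_add)
    then show ?thesis
      by (simp add: pq)
  qed
  then show ?thesis
    using integrable_poly_gaussian[of "2 / T" "p * q"] assms by simp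
qed

section \<open>Positivity of Gram forms and invertibility of \<open>reg_gram_mat\<close>\<close>

lemma scalar_prod_mult_mat_vec:
  assumes "M \<in> carrier_mat n n" and "w \<in> carrier_vec n"
  shows "scalar_prod u (M *\<^sub>v w) =
    (\<Sum>i<n. \<Sum>j<n. vec_index u i * (M $$ (i, j) * vec_index w j))"
  using assms by (auto simp: scalar_prod_def sum_distrib_left lessThan_atLeast0)

text \<open>Integrability of each product allows the two finite sums to move inside the integral,
  where they form a perfect square.\<close>

lemma gram_quadratic_form_nonneg:
  fixes f :: "nat \<Rightarrow> 'a \<Rightarrow> real"
  assumes int: "\<And>i j. i < n \<Longrightarrow> j < n \<Longrightarrow> integrable M (\<lambda>x. f i x * f j x)"
    and u: "u \<in> carrier_vec n"
  shows "scalar_prod u (mat n n (\<lambda>(i, j). LINT x|M. f i x * f j x) *\<^sub>v u) \<ge> 0"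
proof -
  let ?g = "\<lambda>i j x. vec_index u i * vec_index u j * (f i x * f j x)"
  have "scalar_prod u (mat n n (\<lambda>(i, j). LINT x|M. f i x * f j x) *\<^sub>v u) =
      (\<Sum>i<n. \<Sum>j<n. LINT x|M. ?g i j x)"
    using u by (subst scalar_prod_mult_mat_vec[where n = n]) (auto simp: ac_simps)
  also have "\<dots> = (\<Sum>i<n. LINT x|M. (\<Sum>j<n. ?g i j x))"
    using int by (intro sum.cong refl Bochner_Integration.integral_sum[symmetric]) auto
  also have "\<dots> = (LINT x|M. (\<Sum>i<n. \<Sum>j<n. ?g i j x))"
    using int
    by (intro Bochner_Integration.integral_sum[symmetric] Bochner_Integration.integrable_sum) auto
  also have "\<dots> = (LINT x|M. (\<Sum>i<n. vec_index u i * f i x)\<^sup>2)"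
    by (simp add: power2_eq_square sum_product ac_simps)
  also have "\<dots> \<ge> 0"
    by simp
  finally show ?thesis .
qed

lemma smult_mult_mat_vec:
  fixes c :: "'a :: comm_semiring_0"
  assumes "A \<in> carrier_mat m n" and "u \<in> carrier_vec n"
  shows "(c \<cdot>\<^sub>m A) *\<^sub>v u = c \<cdot>\<^sub>v (A *\<^sub>v u)"
  using assms by (intro eq_vecI) (auto simp: scalar_prod_def sum_distrib_left mult.assoc)

lemma gram_mat_carrier: "gram_mat T N \<in> carrier_mat (N + 1) (N + 1)"
  by (simp add: gram_mat_def)

lemma reg_gram_mat_carrier: "reg_gram_mat T \<epsilon> N \<in> carrier_mat (N + 1) (N + 1)"
  by (simp add: gram_mat_carrier reg_gram_mat_def)

lemma D_mat_carrier: "D_mat T N e \<in> carrier_mat (N + 1) (N + 1)"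
  by (simp add: D_mat_def)

lemma transpose_reg_gram_mat: "transpose_mat (reg_gram_mat T \<epsilon> N) = reg_gram_mat T \<epsilon> N"
  by (rule eq_matI) (auto simp: gram_mat_def reg_gram_mat_def mult.commute)

text \<open>This serves twice: it makes the kernel of \<open>reg_gram_mat\<close> trivial, and it
  identifies the conserved quantity with the quadratic form of \<open>reg_gram_mat\<close>.\<close>

lemma reg_gram_quadratic_form:
  assumes "u \<in> carrier_vec (N + 1)"
  shows "scalar_prod u (reg_gram_mat T \<epsilon> N *\<^sub>v u) =
    scalar_prod u (gram_mat T N *\<^sub>v u) + \<epsilon> * scalar_prod u u"
proof -
  have "(\<epsilon> \<cdot>\<^sub>m 1\<^sub>m (N + 1)) *\<^sub>v u = \<epsilon> \<cdot>\<^sub>v u"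
    using assms smult_mult_mat_vec[OF one_carrier_mat assms] by simp
  then have "reg_gram_mat T \<epsilon> N *\<^sub>v u = gram_mat T N *\<^sub>v u + \<epsilon> \<cdot>\<^sub>v u"
    unfolding reg_gram_mat_def using assms
    by (subst add_mult_distrib_mat_vec[OF gram_mat_carrier]) auto
  then show ?thesis
    using assms gram_mat_carrier[of T N]
    by (simp add: scalar_prod_add_distrib[where n = "N + 1"])
qed

text \<open>For a kernel vector u the nonnegative terms
  \<open>scalar_prod u (gram_mat T N *\<^sub>v u)\<close> and
  \<open>\<epsilon> * scalar_prod u u\<close> add up to 0, so u = 0 and the determinant is nonzero.
  The inverse is recorded on the right because \<open>D_bar_mat\<close> will be multiplied by
  \<open>reg_gram_mat\<close> from the left.\<close>

lemma mat_inverse_reg_gram_mat: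
  assumes "T > 0" and "\<epsilon> > 0"
  obtains B where "mat_inverse (reg_gram_mat T \<epsilon> N) = Some B"
    and "B \<in> carrier_mat (N + 1) (N + 1)"
    and "reg_gram_mat T \<epsilon> N * B = 1\<^sub>m (N + 1)"
proof -
  let ?M = "reg_gram_mat T \<epsilon> N" and ?n = "N + 1"
  have "u = 0\<^sub>v ?n" if u: "u \<in> carrier_vec ?n" and "?M *\<^sub>v u = 0\<^sub>v ?n" for u
  proof -
    have "scalar_prod u (gram_mat T N *\<^sub>v u) \<ge> 0"
      unfolding gram_mat_def
      by (intro gram_quadratic_form_nonneg integrable_hermite_fun_mult assms u)
    moreover have "scalar_prod u (gram_mat T N *\<^sub>v u) + \<epsilon> * scalar_prod u u = 0"
      using that reg_gram_quadratic_form[OF u, of T \<epsilon>] by simp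
    ultimately have "scalar_prod u u \<le> 0"
      using \<open>\<epsilon> > 0\<close> by (smt (verit) mult_pos_pos)
    then have "(\<Sum>i<?n. (vec_index u i)\<^sup>2) = 0"
      using u by (intro antisym sum_nonneg)
        (auto simp: scalar_prod_def power2_eq_square lessThan_atLeast0)
    then have "vec_index u i = 0" if "i < ?n" for i
      using that by (subst (asm) sum_nonneg_eq_0_iff) auto
    then show ?thesis
      using u by (intro eq_vecI) auto
  qed
  then have "Determinant.det ?M \<noteq> 0"
    using det_0_iff_vec_prod_zero_field[OF reg_gram_mat_carrier] by blast
  then have "?M \<in> Units (ring_mat TYPE(real) ?n ())"
    by (rule det_non_zero_imp_unit[OF reg_gram_mat_carrier])
  \<comment> \<open>\<open>mat_inverse\<close> returns \<open>None\<close> only for a matrix that is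
    not a unit of the matrix ring.\<close>
  then obtain B where B: "mat_inverse ?M = Some B"
    using mat_inverse(1)[OF reg_gram_mat_carrier, where b = "()"] by fastforce
  then show ?thesis
    using that[OF B] mat_inverse(2)[OF reg_gram_mat_carrier B] by simp
qed

text \<open>Positivity of T and \<epsilon> enters even for the dimensions, since those of
  \<open>the (mat_inverse ...)\<close> are known only once the inverse exists.\<close>

lemma D_bar_mat_carrier:
  assumes "T > 0" and "\<epsilon> > 0"
  shows "D_bar_mat T \<epsilon> N e \<in> carrier_mat (N + 1) (N + 1)"
proof -
  obtain B where "mat_inverse (reg_gram_mat T \<epsilon> N) = Some B" "B \<in> carrier_mat (N + 1) (N + 1)"
    using mat_inverse_reg_gram_mat assms by metis
  then show ?thesis
    using D_mat_carrier[of T N e] reg_gram_mat_carrier[of T \<epsilon> N] by (auto simp: D_bar_mat_def)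
qed

section \<open>Derivative of the quadratic form and its vanishing along solutions\<close>

lemma has_real_derivative_quadratic_form:
  fixes U :: "real \<Rightarrow> real vec"
  assumes M: "M \<in> carrier_mat n n" and sym: "transpose_mat M = M"
    and U: "\<And>s. s \<in> J \<Longrightarrow> U s \<in> carrier_vec n"
    and u': "u' \<in> carrier_vec n"
    and deriv: "has_vec_derivative U u' (at t within J)" and "t \<in> J"
  shows "((\<lambda>s. scalar_prod (U s) (M *\<^sub>v U s)) has_real_derivative
    2 * scalar_prod (U t) (M *\<^sub>v u')) (at t within J)"
proof -
  let ?c = "\<lambda>s i. vec_index (U s) i"
  have component: "((\<lambda>s. ?c s i) has_real_derivative vec_index u' i) (at t within J)" if "i < n" for i
    using deriv u' that by (auto simp: has_vec_derivative_def)
  have entry_sym: "M $$ (j, i) = M $$ (i, j)" if "i < n" "j < n" for i j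
    using sym M that by (metis carrier_matD index_transpose_mat(1))
  have "((\<lambda>s. \<Sum>i<n. \<Sum>j<n. ?c s i * (M $$ (i, j) * ?c s j)) has_real_derivative
      (\<Sum>i<n. \<Sum>j<n. ?c t i * (M $$ (i, j) * vec_index u' j)
        + vec_index u' i * (M $$ (i, j) * ?c t j))) (at t within J)"
    by (intro DERIV_sum) (auto intro!: derivative_eq_intros component)
  also have "(\<Sum>i<n. \<Sum>j<n. ?c t i * (M $$ (i, j) * vec_index u' j)
        + vec_index u' i * (M $$ (i, j) * ?c t j)) = 2 * scalar_prod (U t) (M *\<^sub>v u')"
  proof -
    \<comment> \<open>Exchanging the indices and using symmetry of \<open>M\<close> makes the two
      halves of the product rule equal, whence the factor 2.\<close>
    have "(\<Sum>i<n. \<Sum>j<n. vec_index u' i * (M $$ (i, j) * ?c t j)) =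
        (\<Sum>i<n. \<Sum>j<n. ?c t i * (M $$ (i, j) * vec_index u' j))"
      by (subst sum.swap) (auto intro!: sum.cong simp: entry_sym)
    then show ?thesis
      by (simp add: scalar_prod_mult_mat_vec[OF M u'] sum.distrib)
  qed
  \<comment> \<open>The double sum is known to equal the scalar product only for s in
    \<open>J\<close>, where the dimension of \<open>U s\<close> is given. This covers all of
    \<open>J\<close>, so any positive radius \<open>d\<close> works.\<close>
  finally show ?thesis
    by (rule has_field_derivative_transform_within[where d = 1])
      (simp_all add: scalar_prod_mult_mat_vec[OF M U] \<open>t \<in> J\<close>)
qed

text \<open>\<open>M\<close> moves to the left factor by symmetry, then \<open>D\<close> follows as
  its transpose. This is the skew-symmetry of \<open>M * D - transpose_mat D * M\<close>, expressed
  through its vanishing quadratic form.\<close>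

lemma quadratic_form_mult_eq_transpose_mult:
  fixes M D :: "real mat"
  assumes M: "M \<in> carrier_mat n n" and sym: "transpose_mat M = M"
    and D: "D \<in> carrier_mat n n" and u: "u \<in> carrier_vec n"
  shows "scalar_prod u (M *\<^sub>v (D *\<^sub>v u)) = scalar_prod u (transpose_mat D *\<^sub>v (M *\<^sub>v u))"
proof -
  have Mu: "M *\<^sub>v u \<in> carrier_vec n" and Du: "D *\<^sub>v u \<in> carrier_vec n"
    using M D u by auto
  have "scalar_prod u (M *\<^sub>v (D *\<^sub>v u)) = scalar_prod (M *\<^sub>v u) (D *\<^sub>v u)"
    using transpose_vec_mult_scalar[OF M Du u] sym by simp
  also have "\<dots> = scalar_prod (transpose_mat D *\<^sub>v (M *\<^sub>v u)) u"
    using transpose_vec_mult_scalar[OF D u Mu] by simp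
  also have "\<dots> = scalar_prod u (transpose_mat D *\<^sub>v (M *\<^sub>v u))"
    using D Mu u by (intro comm_scalar_prod[where n = n]) auto
  finally show ?thesis .
qed

lemma reg_gram_D_bar_mat_orthogonal:
  assumes "T > 0" and "\<epsilon> > 0" and u: "u \<in> carrier_vec (N + 1)"
  shows "scalar_prod u (reg_gram_mat T \<epsilon> N *\<^sub>v (D_bar_mat T \<epsilon> N e *\<^sub>v u)) = 0"
proof -
  let ?M = "reg_gram_mat T \<epsilon> N" and ?D = "D_mat T N e" and ?n = "N + 1"
  obtain B where B: "mat_inverse ?M = Some B" "B \<in> carrier_mat ?n ?n" "?M * B = 1\<^sub>m ?n"
    using mat_inverse_reg_gram_mat assms by metis
  note M = reg_gram_mat_carrier[of T \<epsilon> N] and D = D_mat_carrier[of T N e]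
  have Dt: "transpose_mat ?D \<in> carrier_mat ?n ?n"
    using D by simp
  \<comment> \<open>With this w the subtracted term of \<open>D_bar_mat\<close> applied to u is half
    of \<open>B *\<^sub>v w\<close>, and \<open>?M\<close> sends \<open>B *\<^sub>v w\<close> back
    to w.\<close>
  define w where "w = transpose_mat ?D *\<^sub>v (?M *\<^sub>v u)"
  have w: "w \<in> carrier_vec ?n"
    unfolding w_def using Dt M u by (intro mult_mat_vec_carrier)
  have Du: "?D *\<^sub>v u \<in> carrier_vec ?n" and Bw: "B *\<^sub>v w \<in> carrier_vec ?n"
    using D B(2) u w by (auto intro!: mult_mat_vec_carrier)
  have BDM: "B * transpose_mat ?D * ?M \<in> carrier_mat ?n ?n"
    using B(2) Dt M by (intro mult_carrier_mat)
  have "(B * transpose_mat ?D * ?M) *\<^sub>v u = B *\<^sub>v w"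
    using assoc_mult_mat_vec[OF mult_carrier_mat[OF B(2) Dt] M u]
      assoc_mult_mat_vec[OF B(2) Dt mult_mat_vec_carrier[OF M u]]
    by (simp only: w_def)
  then have "D_bar_mat T \<epsilon> N e *\<^sub>v u = (1 / 2) \<cdot>\<^sub>v (?D *\<^sub>v u) - (1 / 2) \<cdot>\<^sub>v (B *\<^sub>v w)"
    unfolding D_bar_mat_def B(1) option.sel
    using D BDM u
    by (subst minus_mult_distrib_mat_vec[where nr = ?n and nc = ?n])
      (auto simp: smult_mult_mat_vec[OF D u] smult_mult_mat_vec[OF BDM u])
  moreover have "?M *\<^sub>v (B *\<^sub>v w) = w"
    using assoc_mult_mat_vec[OF M B(2) w] B(3) w by simp
  ultimately have "?M *\<^sub>v (D_bar_mat T \<epsilon> N e *\<^sub>v u) =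
      (1 / 2) \<cdot>\<^sub>v (?M *\<^sub>v (?D *\<^sub>v u)) - (1 / 2) \<cdot>\<^sub>v w"
    using mult_minus_distrib_mat_vec[OF M, of "(1 / 2) \<cdot>\<^sub>v (?D *\<^sub>v u)" "(1 / 2) \<cdot>\<^sub>v (B *\<^sub>v w)"]
      mult_mat_vec[OF M Du] mult_mat_vec[OF M Bw] Du Bw
    by simp
  then show ?thesis
    using quadratic_form_mult_eq_transpose_mult[OF M transpose_reg_gram_mat D u] M Du u w
    by (simp add: scalar_prod_minus_distrib[where n = ?n] mult_mat_vec_carrier[OF M Du]
        flip: w_def)
qed

theorem lemma5p10:
  fixes T \<epsilon> :: real and N :: nat and e :: "real \<Rightarrow> real"
    and J :: "real set" and U U' :: "real \<Rightarrow> real vec"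
  assumes "T > 0" and "\<epsilon> > 0"
    and "is_interval J"
    and "\<And>t. t \<in> J \<Longrightarrow> U t \<in> carrier_vec (N + 1)"
    and "\<And>t. t \<in> J \<Longrightarrow> U' t \<in> carrier_vec (N + 1)"
    and "\<And>t. t \<in> J \<Longrightarrow> has_vec_derivative U (U' t) (at t within J)"
    and "\<And>t. t \<in> J \<Longrightarrow> U' t + D_bar_mat T \<epsilon> N (e t) *\<^sub>v U t = 0\<^sub>v (N + 1)"
  shows "\<forall>t\<in>J. ((\<lambda>s. scalar_prod (U s) (gram_mat T N *\<^sub>v U s) + \<epsilon> * (euclid_norm (U s))\<^sup>2)
                  has_real_derivative 0) (at t within J)"
proof
  fix t assume t: "t \<in> J"
  let ?M = "reg_gram_mat T \<epsilon> N" and ?n = "N + 1"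
  note M = reg_gram_mat_carrier[of T \<epsilon> N]
  have u: "U t \<in> carrier_vec ?n" and u': "U' t \<in> carrier_vec ?n"
    using assms(4,5) t by auto
  define d where "d = D_bar_mat T \<epsilon> N (e t) *\<^sub>v U t"
  have d: "d \<in> carrier_vec ?n"
    unfolding d_def by (rule mult_mat_vec_carrier[OF D_bar_mat_carrier u]) (rule assms)+
  \<comment> \<open>The equation is multiplied by \<open>?M\<close> and paired with
    \<open>U t\<close>. The term with d drops out by orthogonality, leaving half the derivative of
    the energy equal to 0.\<close>
  have "?M *\<^sub>v (U' t + d) = 0\<^sub>v ?n"
    using assms(7)[OF t] M by (auto simp: d_def scalar_prod_def)
  then have "scalar_prod (U t) (?M *\<^sub>v U' t) + scalar_prod (U t) (?M *\<^sub>v d) = 0"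
    using mult_add_distrib_mat_vec[OF M u' d] M u
      scalar_prod_add_distrib[OF u mult_mat_vec_carrier[OF M u'] mult_mat_vec_carrier[OF M d]]
    by simp
  then have "scalar_prod (U t) (?M *\<^sub>v U' t) = 0"
    using reg_gram_D_bar_mat_orthogonal[OF assms(1,2) u, of "e t"] by (simp add: d_def)
  then have "((\<lambda>s. scalar_prod (U s) (?M *\<^sub>v U s)) has_real_derivative 0) (at t within J)"
    using has_real_derivative_quadratic_form[OF M transpose_reg_gram_mat assms(4) u' assms(6)[OF t] t]
    by simp
  \<comment> \<open>The passage from the form of \<open>?M\<close> to the energy is again made
    within \<open>J\<close>, where \<open>U s\<close> has the required dimension.\<close>
  then show "((\<lambda>s. scalar_prod (U s) (gram_mat T N *\<^sub>v U s) + \<epsilon> * (euclid_norm (U s))\<^sup>2)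
      has_real_derivative 0) (at t within J)"
  proof (rule has_field_derivative_transform_within[where d = 1])
    fix s assume "s \<in> J"
    then show "scalar_prod (U s) (?M *\<^sub>v U s) =
        scalar_prod (U s) (gram_mat T N *\<^sub>v U s) + \<epsilon> * (euclid_norm (U s))\<^sup>2"
      using reg_gram_quadratic_form[OF assms(4), of s T \<epsilon>]
      by (simp add: euclid_norm_def scalar_prod_def sum_nonneg)
  qed (simp_all add: t)
qed

end
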